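(* Let $k$ be a field. There is a functor $M\colon\mathbf{FVect}_k\to\mathbf{Matr}_\bullet$ that sends a vector space $V$ to the matroid with ground set $V$ whose independent sets are the linearly independent subsets of $V$, pointed by $0\in V$, and that acts on morphisms as $M(f)=f$.
   Context: $\mathbf{FVect}_k$ is the category of finite vector spaces over $k$ (vector spaces whose underlying set is finite) and linear maps. All matroids are finite. A strong map between matroids is a function between ground sets such that the inverse image of any flat is a flat. A pointed matroid is a matroid with a distinguished loop $\bullet$ (a loop is an element contained in every flat, equivalently in no independent set); $\mathbf{Matr}_\bullet$ is the category of pointed matroids and strong maps preserving the distinguished loop. *)

theory Defs
  imports "Jordan_Normal_Form.Missing_VectorSpace"
begin

section \<open>Categories and functors\<close>

text \<open>
  Hom-sets of different pairs of objects need not be disjoint: a morphism only makes sense together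
  with its source and target. Hence composition takes the three objects involved as arguments:
  \<open>Comp C X Y Z g f\<close> is the composite of \<open>f\<close> from \<open>X\<close> to \<open>Y\<close> and \<open>g\<close> from \<open>Y\<close> to \<open>Z\<close>.
\<close>

record ('o, 'm) category_data =
  Ob :: "'o set"
  Hom :: "'o \<Rightarrow> 'o \<Rightarrow> 'm set"
  Idm :: "'o \<Rightarrow> 'm"
  Comp :: "'o \<Rightarrow> 'o \<Rightarrow> 'o \<Rightarrow> 'm \<Rightarrow> 'm \<Rightarrow> 'm"

locale category =
  fixes C :: "('o, 'm) category_data"
  assumes Idm_in_Hom: "X \<in> Ob C \<Longrightarrow> Idm C X \<in> Hom C X X"
    and Comp_in_Hom:
      "\<lbrakk>X \<in> Ob C; Y \<in> Ob C; Z \<in> Ob C; f \<in> Hom C X Y; g \<in> Hom C Y Z\<rbrakk>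
        \<Longrightarrow> Comp C X Y Z g f \<in> Hom C X Z"
    and Comp_Idm_right:
      "\<lbrakk>X \<in> Ob C; Y \<in> Ob C; f \<in> Hom C X Y\<rbrakk> \<Longrightarrow> Comp C X X Y f (Idm C X) = f"
    and Comp_Idm_left:
      "\<lbrakk>X \<in> Ob C; Y \<in> Ob C; f \<in> Hom C X Y\<rbrakk> \<Longrightarrow> Comp C X Y Y (Idm C Y) f = f"
    and Comp_assoc:
      "\<lbrakk>W \<in> Ob C; X \<in> Ob C; Y \<in> Ob C; Z \<in> Ob C;
        f \<in> Hom C W X; g \<in> Hom C X Y; h \<in> Hom C Y Z\<rbrakk>
        \<Longrightarrow> Comp C W X Z (Comp C X Y Z h g) f = Comp C W Y Z h (Comp C W X Y g f)"

record ('o, 'm, 'p, 'n) functor_data =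
  on_Ob :: "'o \<Rightarrow> 'p"
  on_Hom :: "'o \<Rightarrow> 'o \<Rightarrow> 'm \<Rightarrow> 'n"

locale covariant_functor = source: category C + target: category D
  for C :: "('o, 'm) category_data" and D :: "('p, 'n) category_data" +
  fixes F :: "('o, 'm, 'p, 'n) functor_data"
  assumes on_Ob_in_Ob: "X \<in> Ob C \<Longrightarrow> on_Ob F X \<in> Ob D"
    and on_Hom_in_Hom:
      "\<lbrakk>X \<in> Ob C; Y \<in> Ob C; f \<in> Hom C X Y\<rbrakk>
        \<Longrightarrow> on_Hom F X Y f \<in> Hom D (on_Ob F X) (on_Ob F Y)"
    and on_Hom_Idm: "X \<in> Ob C \<Longrightarrow> on_Hom F X X (Idm C X) = Idm D (on_Ob F X)"
    and on_Hom_Comp: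
      "\<lbrakk>X \<in> Ob C; Y \<in> Ob C; Z \<in> Ob C; f \<in> Hom C X Y; g \<in> Hom C Y Z\<rbrakk>
        \<Longrightarrow> on_Hom F X Z (Comp C X Y Z g f)
          = Comp D (on_Ob F X) (on_Ob F Y) (on_Ob F Z) (on_Hom F Y Z g) (on_Hom F X Y f)"


section \<open>The category of finite vector spaces\<close>

text \<open>
  In this and in the category of pointed matroids below, the objects are those whose underlying set
  lies in the type \<open>'v\<close> (resp. \<open>'a\<close>), which plays the role of the universe and is arbitrary.
  Morphisms are extensional functions (constantly \<^const>\<open>undefined\<close> outside the source), so that
  equality of morphisms is equality of functions on the underlying sets.

  The fields \<open>mult\<close> and \<open>one\<close> that the record type \<open>module\<close> inherits from rings, and the values
  of addition and scalar multiplication outside the carriers, are unconstrained and play no role;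
  this merely repeats each vector space up to isomorphism.
\<close>

definition FVect :: "('k, 'r) ring_scheme \<Rightarrow> (('k, 'v) module, 'v \<Rightarrow> 'v) category_data" where
  "FVect K =
    \<lparr>Ob = {V. vectorspace K V \<and> finite (carrier V)},
     Hom = (\<lambda>V W. module_hom K V W \<inter> extensional (carrier V)),
     Idm = (\<lambda>V. \<lambda>v\<in>carrier V. v),
     Comp = (\<lambda>U V W g f. compose (carrier U) g f)\<rparr>"


section \<open>The category of pointed matroids\<close>

record 'a matroid =
  ground :: "'a set"
  indeps :: "'a set set"

locale matroid =
  fixes M :: "('a, 'z) matroid_scheme"
  assumes finite_ground: "finite (ground M)"
    and indeps_subset_ground: "I \<in> indeps M \<Longrightarrow> I \<subseteq> ground M"
    and empty_in_indeps: "{} \<in> indeps M"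
    and subset_in_indeps: "\<lbrakk>J \<in> indeps M; I \<subseteq> J\<rbrakk> \<Longrightarrow> I \<in> indeps M"
    and augmentation:
      "\<lbrakk>I \<in> indeps M; J \<in> indeps M; card I < card J\<rbrakk> \<Longrightarrow> \<exists>x\<in>J - I. insert x I \<in> indeps M"

definition matroid_rank :: "('a, 'z) matroid_scheme \<Rightarrow> 'a set \<Rightarrow> nat" where
  "matroid_rank M X = Max (card ` {I \<in> indeps M. I \<subseteq> X})"

definition matroid_closure :: "('a, 'z) matroid_scheme \<Rightarrow> 'a set \<Rightarrow> 'a set" where
  "matroid_closure M X = {x \<in> ground M. matroid_rank M (insert x X) = matroid_rank M X}"

definition flat :: "('a, 'z) matroid_scheme \<Rightarrow> 'a set \<Rightarrow> bool" where
  "flat M F \<longleftrightarrow> F \<subseteq> ground M \<and> matroid_closure M F = F"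

definition loop :: "('a, 'z) matroid_scheme \<Rightarrow> 'a \<Rightarrow> bool" where
  "loop M e \<longleftrightarrow> e \<in> ground M \<and> (\<forall>F. flat M F \<longrightarrow> e \<in> F)"

definition strong_map ::
    "('a, 'z) matroid_scheme \<Rightarrow> ('b, 'y) matroid_scheme \<Rightarrow> ('a \<Rightarrow> 'b) \<Rightarrow> bool" where
  "strong_map M N f \<longleftrightarrow>
    f \<in> ground M \<rightarrow> ground N \<and> (\<forall>F. flat N F \<longrightarrow> flat M (f -` F \<inter> ground M))"

record 'a pointed_matroid = "'a matroid" +
  point :: 'a

definition Matr_pointed :: "('a pointed_matroid, 'a \<Rightarrow> 'a) category_data" where
  "Matr_pointed =
    \<lparr>Ob = {M. matroid M \<and> loop M (point M)},
     Hom = (\<lambda>M N. {f \<in> extensional (ground M). strong_map M N f \<and> f (point M) = point N}),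
     Idm = (\<lambda>M. \<lambda>x\<in>ground M. x),
     Comp = (\<lambda>L M N g f. compose (ground L) g f)\<rparr>"

end

theory Submission
  imports Defs
begin

text \<open>
  The heart of the matter is that the flats of the matroid of a finite vector space are exactly its
  subspaces. Indeed, the rank of a set \<open>X\<close> of vectors is the size of a basis \<open>B\<close> of its span chosen
  inside \<open>X\<close>. Adding to \<open>X\<close> a vector of the span cannot raise the rank, by the Steinitz bound
  (\<open>lin_indpt_card_le\<close>); adding one outside the span does, since it extends \<open>B\<close>. Hence the matroid
  closure is the linear span (\<open>closure_vector_matroid\<close>), and its fixed points are the subspaces
  (\<open>flat_vector_matroid_iff\<close>).

  Everything else follows from this. Preimages of subspaces under a linear map are subspaces, so
  linear maps are strong; every subspace contains \<open>0\<close>, so \<open>0\<close> is a loop; and linear maps preserve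
  \<open>0\<close>. The matroid axioms themselves come from the same Steinitz bound: if no element of \<open>J\<close> extends
  \<open>I\<close>, then \<open>J\<close> lies in the span of \<open>I\<close>. Functoriality is immediate because both categories are
  concrete, with the same identities and the same composition, and the functor fixes the functions.
\<close>

section \<open>Concrete categories\<close>

text \<open>
  Extensionality is what makes the unit laws hold: an extensional function is determined by its values
  on the carrier, hence absorbs the restricted identities on both sides.
\<close>

lemma category_of_extensional_maps:
  assumes hom_maps: "\<And>X Y f. \<lbrakk>X \<in> obs; Y \<in> obs; f \<in> mor X Y\<rbrakk>
      \<Longrightarrow> f \<in> extensional (A X) \<and> f \<in> A X \<rightarrow> A Y"
    and id: "\<And>X. X \<in> obs \<Longrightarrow> (\<lambda>x\<in>A X. x) \<in> mor X X"
    and comp: "\<And>X Y Z f g. \<lbrakk>X \<in> obs; Y \<in> obs; Z \<in> obs; f \<in> mor X Y; g \<in> mor Y Z\<rbrakk>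
      \<Longrightarrow> compose (A X) g f \<in> mor X Z"
  shows "category \<lparr>Ob = obs, Hom = mor, Idm = (\<lambda>X. \<lambda>x\<in>A X. x),
           Comp = (\<lambda>X Y Z g f. compose (A X) g f)\<rparr>"
proof (unfold_locales, simp_all add: id comp)
  show "compose (A X) f (\<lambda>x\<in>A X. x) = f" if "X \<in> obs" "Y \<in> obs" "f \<in> mor X Y" for X Y f
    using hom_maps[OF that] by (intro compose_Id) auto
  show "compose (A X) (\<lambda>y\<in>A Y. y) f = f" if "X \<in> obs" "Y \<in> obs" "f \<in> mor X Y" for X Y f
    using hom_maps[OF that] by (intro Id_compose) auto
  show "compose (A W) (compose (A X) h g) f = compose (A W) h (compose (A W) g f)"
    if "W \<in> obs" "X \<in> obs" "f \<in> mor W X" for W X f g h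
    using hom_maps[OF that] compose_assoc[of f "A W" "A X" h g] by simp
qed

lemma compose_in_module_hom:
  assumes "f \<in> module_hom K U V" and "g \<in> module_hom K V W"
    and "module K U"
  shows "compose (carrier U) g f \<in> module_hom K U W"
proof -
  interpret module K U by fact
  have "f x \<in> carrier V" if "x \<in> carrier U" for x
    using module_hom_closed[OF assms(1)] that by auto
  then show ?thesis
    using assms(1,2) by (auto simp: module_hom_def compose_def Pi_iff)
qed

lemma category_FVect:
  fixes K :: "('k, 'r) ring_scheme"
  shows "category (FVect K :: (('k, 'v) module, 'v \<Rightarrow> 'v) category_data)"
  unfolding FVect_def
proof (rule category_of_extensional_maps)
  show "(\<lambda>v\<in>carrier V. v) \<in> module_hom K V V \<inter> extensional (carrier V)"
    if "V \<in> {V. vectorspace K V \<and> finite (carrier V)}" for V :: "('k, 'v) module"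
  proof -
    from that interpret vectorspace K V by simp
    show ?thesis by (auto simp: module_hom_def)
  qed
qed (auto simp: vectorspace_def dest: module_hom_closed intro!: compose_in_module_hom)

lemma strong_map_id: "strong_map M M (\<lambda>x\<in>ground M. x)"
proof -
  have "(\<lambda>x\<in>ground M. x) -` F \<inter> ground M = F" if "flat M F" for F
    using that by (auto simp: flat_def)
  then show ?thesis by (simp add: strong_map_def)
qed

lemma strong_map_compose:
  assumes f: "strong_map L M f" and g: "strong_map M N g"
  shows "strong_map L N (compose (ground L) g f)"
proof -
  have "compose (ground L) g f -` F \<inter> ground L = f -` (g -` F \<inter> ground M) \<inter> ground L" for F
    using f by (auto simp: strong_map_def compose_def)
  then show ?thesis
    using f g by (auto simp: strong_map_def compose_def)
qed

lemma category_Matr_pointed: "category Matr_pointed"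
  unfolding Matr_pointed_def
proof (rule category_of_extensional_maps)
  show "(\<lambda>x\<in>ground M. x) \<in> {f \<in> extensional (ground M). strong_map M M f \<and> f (point M) = point M}"
    if "M \<in> {M. matroid M \<and> loop M (point M)}" for M :: "'a pointed_matroid"
    using that strong_map_id[of M] by (simp add: loop_def)
  show "compose (ground L) g f
      \<in> {f \<in> extensional (ground L). strong_map L N f \<and> f (point L) = point N}"
    if "L \<in> {M. matroid M \<and> loop M (point M)}"
      and "f \<in> {f \<in> extensional (ground L). strong_map L M f \<and> f (point L) = point M}"
      and "g \<in> {f \<in> extensional (ground M). strong_map M N f \<and> f (point M) = point N}"
    for L M N :: "'a pointed_matroid" and f g
    using that strong_map_compose[of L M f N g]
    by (simp add: loop_def compose_eq)
qed (auto simp: strong_map_def)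


section \<open>Linear algebra\<close>

context vectorspace
begin

lemma lin_indpt_empty: "lin_indpt {}"
  by (simp add: lin_dep_def)

lemma lin_indpt_insert:
  assumes "S \<subseteq> carrier V" "lin_indpt S" "v \<in> carrier V" "v \<notin> span S"
  shows "v \<notin> S" and "lin_indpt (insert v S)"
proof -
  show "v \<notin> S" using assms in_own_span by blast
  then show "lin_indpt (insert v S)"
    using assms lin_dep_iff_in_span[of S v] by simp
qed

text \<open>
  This Steinitz bound is the size estimate of the replacement theorem, with the generated space
  allowed to be smaller than the whole of \<open>V\<close>.
\<close>

lemma lin_indpt_card_le:
  assumes "finite A" "finite B" "B \<subseteq> carrier V" "lin_indpt A" "A \<subseteq> span B"
  shows "card A \<le> card B"
proof -
  obtain C :: "'c set" where "int (card C) \<le> int (card B) - int (card A)"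
    using replacement[OF assms] by auto
  then show ?thesis by linarith
qed

lemma submodule_iff_span_eq:
  assumes "F \<subseteq> carrier V"
  shows "submodule K F V \<longleftrightarrow> span F = F"
  using assms in_own_span[of F] span_is_subset[of F F] span_is_submodule[of F] by auto

end

lemma submodule_vimage:
  assumes "mod_hom K V W f" and "submodule K F W"
  shows "submodule K (f -` F \<inter> carrier V) V"
proof -
  interpret mod_hom K V W f by fact
  interpret F: submodule K F W by fact
  show ?thesis by unfold_locales auto
qed


section \<open>The matroid of a finite vector space\<close>

definition vector_matroid ::
    "('k, 'r) ring_scheme \<Rightarrow> ('k, 'v, 'm) module_scheme \<Rightarrow> 'v pointed_matroid" where
  "vector_matroid K V =
    \<lparr>ground = carrier V,
     indeps = {I. I \<subseteq> carrier V \<and> \<not> module.lin_dep K V I},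
     point = \<zero>\<^bsub>V\<^esub>\<rparr>"

locale finite_vectorspace = vectorspace +
  assumes finite_carrier: "finite (carrier V)"
begin

lemma ground_vector_matroid [simp]: "ground (vector_matroid K V) = carrier V"
  and point_vector_matroid [simp]: "point (vector_matroid K V) = \<zero>\<^bsub>V\<^esub>"
  and indeps_vector_matroid_iff:
    "I \<in> indeps (vector_matroid K V) \<longleftrightarrow> I \<subseteq> carrier V \<and> lin_indpt I"
  by (simp_all add: vector_matroid_def)

lemma finite_subset_carrier: "A \<subseteq> carrier V \<Longrightarrow> finite A"
  using finite_carrier finite_subset by blast

lemma matroid_vector_matroid: "matroid (vector_matroid K V)"
proof
  fix I J
  assume I: "I \<in> indeps (vector_matroid K V)" and J: "J \<in> indeps (vector_matroid K V)"
    and less: "card I < card J"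
  have "\<not> J \<subseteq> span I"
    using I J less lin_indpt_card_le[of J I]
    by (auto simp: indeps_vector_matroid_iff finite_subset_carrier)
  then obtain x where "x \<in> J" "x \<notin> span I" by blast
  then show "\<exists>x\<in>J - I. insert x I \<in> indeps (vector_matroid K V)"
    using I J lin_indpt_insert[of I x] by (auto simp: indeps_vector_matroid_iff)
qed (auto simp: indeps_vector_matroid_iff finite_carrier lin_indpt_empty dest: subset_li_is_li)

text \<open>
  A basis of the span can be picked inside any generating set: an independent subset of \<open>X\<close> of
  largest size will do, since a vector of \<open>X\<close> outside its span would enlarge it.
\<close>

lemma lin_indpt_spanning_subset_exists:
  assumes "X \<subseteq> carrier V"
  obtains B where "B \<subseteq> X" "lin_indpt B" "span B = span X"
proof -
  let ?S = "{B. B \<subseteq> X \<and> lin_indpt B}"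
  have "finite X" using assms by (rule finite_subset_carrier)
  then have "\<forall>B. B \<in> ?S \<longrightarrow> card B < Suc (card X)" by (simp add: card_mono less_Suc_eq_le)
  moreover have "{} \<in> ?S" by (simp add: lin_indpt_empty)
  ultimately have "\<exists>B. B \<in> ?S \<and> (\<forall>C. C \<in> ?S \<longrightarrow> card C \<le> card B)"
    by (intro ex_has_greatest_nat[of "\<lambda>B. B \<in> ?S"])
  then obtain B where B: "B \<in> ?S" and largest: "\<And>C. C \<in> ?S \<Longrightarrow> card C \<le> card B"
    by blast
  have "X \<subseteq> span B"
  proof
    fix x assume x: "x \<in> X"
    show "x \<in> span B"
    proof (rule ccontr)
      assume "x \<notin> span B"
      then have "x \<notin> B" "insert x B \<in> ?S"
        using B x assms lin_indpt_insert[of B x] by auto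
      moreover have "finite B" using B \<open>finite X\<close> finite_subset by blast
      ultimately show False using largest[of "insert x B"] by simp
    qed
  qed
  moreover have "B \<subseteq> carrier V" using B assms by blast
  ultimately have "span X \<subseteq> span B"
    by (intro span_is_subset span_is_submodule)
  then have "span B = span X"
    using B span_is_monotone[of B X] by blast
  with B that show thesis by blast
qed

lemma matroid_rank_eq_card:
  assumes X: "X \<subseteq> carrier V" and B: "B \<subseteq> X" "lin_indpt B" "X \<subseteq> span B"
  shows "matroid_rank (vector_matroid K V) X = card B"
  unfolding matroid_rank_def
proof (rule Max_eqI)
  let ?S = "{I \<in> indeps (vector_matroid K V). I \<subseteq> X}"
  have "?S \<subseteq> Pow X" by blast
  then show "finite (card ` ?S)"
    using finite_subset_carrier[OF X] by (meson finite_Pow_iff finite_imageI finite_subset)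
  show "card B \<in> card ` ?S"
    using X B by (auto simp: indeps_vector_matroid_iff)
  show "y \<le> card B" if "y \<in> card ` ?S" for y
    using that X B lin_indpt_card_le[of _ B]
    by (auto simp: indeps_vector_matroid_iff finite_subset_carrier)
qed

text \<open>
  One basis \<open>B \<subseteq> X\<close> of the span serves for both ranks: for \<open>x\<close> in the span it still witnesses the rank
  of \<open>insert x X\<close>, and otherwise \<open>insert x B\<close> does, which has one element more.
\<close>

lemma closure_vector_matroid:
  assumes X: "X \<subseteq> carrier V"
  shows "matroid_closure (vector_matroid K V) X = span X"
proof -
  obtain B where B: "B \<subseteq> X" "lin_indpt B" and span: "span B = span X"
    using lin_indpt_spanning_subset_exists[OF X] .
  have BV: "B \<subseteq> carrier V" and XB: "X \<subseteq> span B"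
    using B X span in_own_span[OF X] by auto
  have rank: "matroid_rank (vector_matroid K V) X = card B"
    using X B XB by (rule matroid_rank_eq_card)
  have "matroid_rank (vector_matroid K V) (insert x X) = card B \<longleftrightarrow> x \<in> span B"
    if x: "x \<in> carrier V" for x
  proof (cases "x \<in> span B")
    case True
    then show ?thesis
      using X B XB x matroid_rank_eq_card[of "insert x X" B] by auto
  next
    case False
    have xB: "x \<notin> B" "lin_indpt (insert x B)"
      using lin_indpt_insert[OF BV B(2) x False] by auto
    have "span B \<subseteq> span (insert x B)" "x \<in> span (insert x B)"
      using span_is_monotone[of B "insert x B"] in_own_span[of "insert x B"] BV x by auto
    then have "matroid_rank (vector_matroid K V) (insert x X) = card (insert x B)"
      using X B XB x xB by (intro matroid_rank_eq_card) auto
    then show ?thesis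
      using False xB BV finite_subset_carrier by simp
  qed
  moreover have "span B \<subseteq> carrier V" using BV by (rule span_is_subset2)
  ultimately show ?thesis
    using rank span by (auto simp: matroid_closure_def)
qed

lemma flat_vector_matroid_iff: "flat (vector_matroid K V) F \<longleftrightarrow> submodule K F V"
proof (cases "F \<subseteq> carrier V")
  case True
  then show ?thesis
    by (simp add: flat_def closure_vector_matroid submodule_iff_span_eq)
next
  case False
  then show ?thesis by (auto simp: flat_def submodule_def)
qed

lemma loop_zero: "loop (vector_matroid K V) \<zero>\<^bsub>V\<^esub>"
  by (simp add: loop_def flat_vector_matroid_iff submodule.zero_closed)

end

lemma strong_map_of_linear:
  assumes "finite_vectorspace K V" "finite_vectorspace K W" "mod_hom K V W f"
  shows "strong_map (vector_matroid K V) (vector_matroid K W) f"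
proof -
  interpret V: finite_vectorspace K V by fact
  interpret W: finite_vectorspace K W by fact
  interpret f: mod_hom K V W f by fact
  show ?thesis
    using submodule_vimage[OF assms(3)]
    by (simp add: strong_map_def V.flat_vector_matroid_iff W.flat_vector_matroid_iff)
qed


section \<open>The functor\<close>

theorem proposition7p16:
  fixes K :: "('k, 'r) ring_scheme"
  assumes "field K"
  shows "\<exists>M :: (('k, 'v) module, 'v \<Rightarrow> 'v, 'v pointed_matroid, 'v \<Rightarrow> 'v) functor_data.
    covariant_functor (FVect K) Matr_pointed M \<and>
    (\<forall>V \<in> Ob (FVect K).
      on_Ob M V =
        \<lparr>ground = carrier V,
         indeps = {I. I \<subseteq> carrier V \<and> \<not> module.lin_dep K V I},
         point = \<zero>\<^bsub>V\<^esub>\<rparr>) \<and>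
    (\<forall>V \<in> Ob (FVect K). \<forall>W \<in> Ob (FVect K). \<forall>f \<in> Hom (FVect K) V W. on_Hom M V W f = f)"
proof -
  define M :: "(('k, 'v) module, 'v \<Rightarrow> 'v, 'v pointed_matroid, 'v \<Rightarrow> 'v) functor_data"
    where "M = \<lparr>on_Ob = vector_matroid K, on_Hom = (\<lambda>V W f. f)\<rparr>"
  have fin: "finite_vectorspace K V" if "V \<in> Ob (FVect K)" for V :: "('k, 'v) module"
    using that by (simp add: FVect_def finite_vectorspace_def finite_vectorspace_axioms_def)
  have "covariant_functor (FVect K) Matr_pointed M"
  proof (intro covariant_functor.intro category_FVect category_Matr_pointed
      covariant_functor_axioms.intro)
    fix V :: "('k, 'v) module" assume "V \<in> Ob (FVect K)"
    then interpret finite_vectorspace K V by (rule fin)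
    show "on_Ob M V \<in> Ob Matr_pointed"
      by (simp add: M_def Matr_pointed_def matroid_vector_matroid loop_zero)
    show "on_Hom M V V (Idm (FVect K) V) = Idm Matr_pointed (on_Ob M V)"
      by (simp add: M_def FVect_def Matr_pointed_def)
  next
    fix V W :: "('k, 'v) module" and f
    assume V: "V \<in> Ob (FVect K)" and W: "W \<in> Ob (FVect K)" and f: "f \<in> Hom (FVect K) V W"
    interpret V: finite_vectorspace K V using V by (rule fin)
    interpret W: finite_vectorspace K W using W by (rule fin)
    interpret f: mod_hom K V W f
      using f by unfold_locales (simp add: FVect_def)
    show "on_Hom M V W f \<in> Hom Matr_pointed (on_Ob M V) (on_Ob M W)"
      using f strong_map_of_linear[OF V.finite_vectorspace_axioms W.finite_vectorspace_axioms
          f.mod_hom_axioms]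
      by (simp add: M_def FVect_def Matr_pointed_def)
  next
    fix U V W :: "('k, 'v) module" and f g
    assume "U \<in> Ob (FVect K)"
    then interpret finite_vectorspace K U by (rule fin)
    show "on_Hom M U W (Comp (FVect K) U V W g f)
        = Comp Matr_pointed (on_Ob M U) (on_Ob M V) (on_Ob M W) (on_Hom M V W g) (on_Hom M U V f)"
      by (simp add: M_def FVect_def Matr_pointed_def)
  qed
  then show ?thesis
    by (intro exI[of _ M]) (simp add: M_def vector_matroid_def)
qed

end
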